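(* Let $\mathbb{A}$ be a finite non-empty set, let $y\in\mathbb{A}^{\mathbb{N}}$ be Lyndon relative to some linear order $\leq$ on $\mathbb{A}$, and let $z\in\mathbb{A}^{\mathbb{N}}$ be any point in the shift orbit closure of $y$. Then for each $w\in\mathscr{S}(y,z)$ we have $w<_{\mathrm{lex}}z$. In particular (taking $z=y$), $y$ is not self-shuffling.
   Context: For infinite words $y,z\in\mathbb{A}^{\mathbb{N}}$, $\mathscr{S}(y,z)\subseteq\mathbb{A}^{\mathbb{N}}$ is the set of infinite words $w$ for which there are finite (possibly empty) words $U_i,V_i\in\mathbb{A}^*$, $i\ge0$, with $w=\prod_{i=0}^\infty U_iV_i$, $y=\prod_{i=0}^\infty U_i$ and $z=\prod_{i=0}^\infty V_i$. A word $x\in\mathbb{A}^{\mathbb{N}}$ is self-shuffling if $x\in\mathscr{S}(x,x)$. For a linear order $\leq$ on $\mathbb{A}$, $<_{\mathrm{lex}}$ denotes the induced strict lexicographic order on $\mathbb{A}^{\mathbb{N}}$. The word $y\in\mathbb{A}^{\mathbb{N}}$ is Lyndon relative to $\leq$ if $y<_{\mathrm{lex}}y'$ for every proper suffix (tail) $y'$ of $y$. The shift orbit closure of $y$ is the set of infinite words all of whose finite factors are factors of $y$. *)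

theory Defs
  imports "HOL-Library.Omega_Words_Fun"
begin

text \<open>
  The library type \<^typ>\<open>'a word\<close> consists of the functions \<^typ>\<open>nat \<Rightarrow> 'a\<close>. An infinite word
  over the alphabet \<open>A\<close> is a \<open>w\<close> with \<open>range w \<subseteq> A\<close>, a finite word over \<open>A\<close> is an element
  of \<open>lists A\<close>, and a linear order on \<open>A\<close> is a reflexive relation \<open>r\<close> with
  \<open>linear_order_on A r\<close>.
\<close>

text \<open>
  The blocks \<open>W i\<close> may be empty, so it has to be required that the product is an infinite word:
  the lengths of the partial products are unbounded.
\<close>

definition is_inf_prod :: "(nat \<Rightarrow> 'a list) \<Rightarrow> 'a word \<Rightarrow> bool" where
  "is_inf_prod W w \<longleftrightarrow>
    (\<forall>n. prefix (length (concat (map W [0..<n]))) w = concat (map W [0..<n])) \<and>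
    (\<forall>k. \<exists>n. k \<le> length (concat (map W [0..<n])))"

definition inf_shuffles :: "'a set \<Rightarrow> 'a word \<Rightarrow> 'a word \<Rightarrow> 'a word set" where
  "inf_shuffles A y z = {w. \<exists>U V. (\<forall>i. U i \<in> lists A \<and> V i \<in> lists A) \<and>
    is_inf_prod (\<lambda>i. U i @ V i) w \<and> is_inf_prod U y \<and> is_inf_prod V z}"

definition self_shuffling :: "'a set \<Rightarrow> 'a word \<Rightarrow> bool" where
  "self_shuffling A x \<longleftrightarrow> x \<in> inf_shuffles A x x"

definition lex_less :: "'a rel \<Rightarrow> 'a word \<Rightarrow> 'a word \<Rightarrow> bool" where
  "lex_less r x y \<longleftrightarrow> (\<exists>n. (\<forall>i<n. x i = y i) \<and> x n \<noteq> y n \<and> (x n, y n) \<in> r)"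

text \<open>
  The proper suffixes are the tails at positions \<open>k > 0\<close>. Such a tail may coincide with \<open>y\<close> as
  a word (if \<open>y\<close> is periodic); then \<open>y\<close> is not Lyndon.
\<close>

definition lyndon :: "'a rel \<Rightarrow> 'a word \<Rightarrow> bool" where
  "lyndon r y \<longleftrightarrow> (\<forall>k>0. lex_less r y (suffix k y))"

definition factors :: "'a word \<Rightarrow> 'a list set" where
  "factors x = {x [i \<rightarrow> j] | i j. i \<le> j}"

text \<open>
  Since one-letter factors are included, every word in the closure of a word over \<open>A\<close> is again
  a word over \<open>A\<close>.
\<close>

definition shift_orbit_closure :: "'a word \<Rightarrow> 'a word set" where
  "shift_orbit_closure y = {x. factors x \<subseteq> factors y}"

end

theory Submission
  imports Defs "HOL-Library.List_Lexorder"
begin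

text \<open>
  The heart of the matter is a fact on finite words: a finite Lyndon word \<open>v\<close> is strictly above
  every shuffle of two nonempty prefixes of \<open>v\<close> whose lengths add up to that of \<open>v\<close>
  (\<open>lyndon_list_above_own_shuffles\<close>). It is proved by induction on the length. The least period
  of \<open>v\<close> without its last letter is the length of a shorter Lyndon word \<open>u\<close>, so that
  \<open>v = u\<^sup>k u' c\<close> with \<open>u'\<close> a proper prefix of \<open>u\<close> and \<open>c\<close> larger than the letter that would
  continue the period. Read a shuffle of two prefixes of \<open>v\<close> in pieces of length \<open>|u|\<close>. By the
  induction hypothesis, the first piece that mixes both words falls below \<open>u\<close>; if there is
  none, every piece is a copy of \<open>u\<close> taken from one of the two words, and the rest is read from
  words that are again of the form \<open>u\<^sup>i u' c\<close>. At the end, the large letter \<open>c\<close> can only be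
  reached in time if all letters were taken from the same word.

  Now let \<open>w\<close> be a shuffle of \<open>y\<close> and \<open>z\<close>. An initial run of letters taken from \<open>z\<close> is common to
  \<open>w\<close> and \<open>z\<close>; after it is removed, \<open>w\<close> starts with a letter from \<open>y\<close>, and still no factor of \<open>z\<close>
  is below the prefix of \<open>y\<close> of the same length. It remains to find a Lyndon prefix \<open>v\<close> of \<open>z\<close>
  such that the prefix of \<open>w\<close> of length \<open>|v|\<close> is a shuffle of two nonempty prefixes of \<open>v\<close>.

  \<^item> If \<open>z \<noteq> y\<close>, let \<open>d\<close> be the first place where they differ. Then \<open>z\<close> is larger there, and a
    prefix of a Lyndon word becomes a finite Lyndon word when its last letter is increased
    (\<open>raised_prefix_lyndon\<close>), so the prefix of \<open>z\<close> of length \<open>d + 1\<close> serves as \<open>v\<close>. (If \<open>w\<close> has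
    taken all its first \<open>d + 1\<close> letters from \<open>y\<close>, it is below \<open>z\<close> anyway.)

  \<^item> If \<open>z = y\<close>, any Lyndon prefix serves that is so long that \<open>w\<close> has taken letters from both
    words. Such prefixes exist (\<open>lyndon_long_lyndon_prefix\<close>): the least periods of the prefixes
    of \<open>y\<close> are lengths of Lyndon prefixes, and they are unbounded because \<open>y\<close> is not periodic.

  A finite alphabet with a linear order is isomorphic to a set of natural numbers, so the argument
  is carried out for words over a linearly ordered type.
\<close>

section \<open>Lexicographic order and shuffles of finite words\<close>

lemma append_less_append:
  fixes u v s t :: "'a::linorder list"
  assumes "u < v" and "length u = length v"
  shows "u @ s < v @ t"
  using assms by (simp add: list_less_def lexord_sufI)

lemma append_less_append_same:
  fixes s t :: "'a::linorder list"
  shows "s < t \<Longrightarrow> u @ s < u @ t"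
  by (simp add: list_less_def lexord_append_leftI)

lemma less_list_iff_first_difference:
  fixes u v :: "'a::linorder list"
  assumes "length u = length v"
  shows "u < v \<longleftrightarrow> (\<exists>i<length v. (\<forall>j<i. u ! j = v ! j) \<and> u ! i < v ! i)"
proof -
  have "take i u = take i v \<longleftrightarrow> (\<forall>j<i. u ! j = v ! j)" if "i < length v" for i
    using that assms by (auto simp: list_eq_iff_nth_eq)
  then show ?thesis
    using assms by (auto simp: list_less_def lexord_take_index_conv)
qed

lemma shuffles_append:
  assumes "x \<in> shuffles p q" and "x' \<in> shuffles p' q'"
  shows "x @ x' \<in> shuffles (p @ p') (q @ q')"
  using assms(1)
proof (induction x arbitrary: p q)
  case Nil
  then show ?case using assms(2) by simp
next
  case (Cons c x)
  from Cons.prems consider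
    p1 where "p = c # p1" "x \<in> shuffles p1 q" | q1 where "q = c # q1" "x \<in> shuffles p q1"
    by (auto simp: Cons_in_shuffles_iff neq_Nil_conv)
  then show ?case
    by cases (auto dest!: Cons.IH intro: Cons_in_shuffles_leftI Cons_in_shuffles_rightI)
qed

text \<open>
  Cutting a shuffle cuts the two shuffled words as well. This is what allows a shuffle of long words
  to be compared piece by piece.
\<close>

lemma shuffles_split:
  assumes "x \<in> shuffles p q" and "k \<le> length x"
  obtains a b where "a + b = k" "a \<le> length p" "b \<le> length q"
    "take k x \<in> shuffles (take a p) (take b q)" "drop k x \<in> shuffles (drop a p) (drop b q)"
proof -
  have "\<exists>a b. a + b = k \<and> a \<le> length p \<and> b \<le> length q \<and>
    take k x \<in> shuffles (take a p) (take b q) \<and> drop k x \<in> shuffles (drop a p) (drop b q)"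
    using assms
  proof (induction k arbitrary: x p q)
    case 0
    then show ?case by (intro exI[of _ 0]) simp
  next
    case (Suc k)
    then obtain c x1 where x: "x = c # x1" by (cases x) auto
    with Suc.prems consider
      p1 where "p = c # p1" "x1 \<in> shuffles p1 q" | q1 where "q = c # q1" "x1 \<in> shuffles p q1"
      by (auto simp: Cons_in_shuffles_iff neq_Nil_conv)
    then show ?case
    proof cases
      case 1
      with Suc.IH[of x1 p1 q] Suc.prems x obtain a b where "a + b = k" "a \<le> length p1"
        "b \<le> length q" "take k x1 \<in> shuffles (take a p1) (take b q)"
        "drop k x1 \<in> shuffles (drop a p1) (drop b q)" by auto
      with 1 x show ?thesis
        by (intro exI[of _ "Suc a"] exI[of _ b]) (auto intro: Cons_in_shuffles_leftI)
    next
      case 2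
      with Suc.IH[of x1 p q1] Suc.prems x obtain a b where "a + b = k" "a \<le> length p"
        "b \<le> length q1" "take k x1 \<in> shuffles (take a p) (take b q1)"
        "drop k x1 \<in> shuffles (drop a p) (drop b q1)" by auto
      with 2 x show ?thesis
        by (intro exI[of _ a] exI[of _ "Suc b"]) (auto intro: Cons_in_shuffles_rightI)
    qed
  qed
  then show ?thesis using that by blast
qed

section \<open>Finite Lyndon words and least periods\<close>

text \<open>
  A Lyndon word is below each of its proper suffixes, and the comparison is decided by a letter inside
  the word: a Lyndon word has no proper suffix that is also a prefix. Positions are spelled out here
  because the proofs below relate the comparisons at several offsets.
\<close>

definition lyndon_list :: "'a::linorder list \<Rightarrow> bool" where
  "lyndon_list v \<longleftrightarrow> v \<noteq> [] \<and> (\<forall>k. 0 < k \<and> k < length v \<longrightarrow>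
    (\<exists>i. k + i < length v \<and> (\<forall>j<i. v ! (k + j) = v ! j) \<and> v ! i < v ! (k + i)))"

text \<open>
  The weak version, in which a suffix may also be a prefix, is the property that is inherited by
  prefixes.
\<close>

definition below_suffixes :: "'a::linorder list \<Rightarrow> bool" where
  "below_suffixes v \<longleftrightarrow>
    (\<forall>k i. k + i < length v \<and> (\<forall>j<i. v ! (k + j) = v ! j) \<longrightarrow> v ! i \<le> v ! (k + i))"

definition is_period :: "nat \<Rightarrow> 'a list \<Rightarrow> bool" where
  "is_period p v \<longleftrightarrow> 0 < p \<and> (\<forall>i. i + p < length v \<longrightarrow> v ! (i + p) = v ! i)"

text \<open>
  If \<open>p\<close> is the least period, an offset \<open>0 < k < p\<close> is not a period, so the suffix at \<open>k\<close> first
  differs from the word at some place \<open>i\<close>, and is larger there. This place lies within the first period: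
  otherwise, going back by \<open>p\<close> from the large letter at \<open>k + i\<close>, the suffix at \<open>p - k\<close> would first
  differ from the word at the place \<open>k + i - p\<close>, and would be smaller.
\<close>

lemma least_period_lyndon:
  fixes s :: "'a::linorder list"
  assumes "below_suffixes s" and "s \<noteq> []"
  obtains p where "is_period p s" "p \<le> length s" "lyndon_list (take p s)"
proof -
  define p where "p = (LEAST p. is_period p s)"
  have *: "is_period (length s) s" using assms(2) by (auto simp: is_period_def)
  have per: "is_period p s" unfolding p_def using * by (rule LeastI)
  have le: "p \<le> length s" unfolding p_def using * by (rule Least_le)
  have least: "\<not> is_period k s" if "k < p" for k
    using that not_less_Least unfolding p_def by blast
  have ex: "\<exists>i. k + i < p \<and> (\<forall>j<i. s ! (k + j) = s ! j) \<and> s ! i < s ! (k + i)"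
    if k: "0 < k" "k < p" for k
  proof -
    let ?P = "\<lambda>i. k + i < length s \<and> s ! (k + i) \<noteq> s ! i"
    have "\<exists>i. ?P i" using least[OF k(2)] k(1) by (auto simp: is_period_def add.commute)
    then have P: "?P (LEAST i. ?P i)" by (rule LeastI_ex)
    define i where "i = (LEAST i. ?P i)"
    have i: "k + i < length s" "s ! (k + i) \<noteq> s ! i" using P by (auto simp: i_def)
    have eq: "s ! (k + j) = s ! j" if "j < i" for j
      using not_less_Least[of j ?P] that i(1) unfolding i_def by auto
    have lt: "s ! i < s ! (k + i)"
      using assms(1) i eq unfolding below_suffixes_def by (metis order_le_less)
    have "k + i < p"
    proof (rule ccontr)
      \<comment> \<open>The place \<open>j\<close> is compared with \<open>j + p = k + i\<close> by periodicity and with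
        \<open>(p - k) + j = i\<close> as the first difference at the offset \<open>p - k\<close>.\<close>
      assume "\<not> k + i < p"
      define j where "j = k + i - p"
      have j: "j + p = k + i" "j < i" "(p - k) + j = i"
        using \<open>\<not> k + i < p\<close> k by (auto simp: j_def)
      have "s ! (p - k + j') = s ! j'" if "j' < j" for j'
      proof -
        have "s ! (k + (p - k + j')) = s ! (p - k + j')" by (rule eq) (use that j in linarith)
        then have "s ! (p - k + j') = s ! (k + (p - k + j'))" ..
        also have "\<dots> = s ! (j' + p)" using k by (simp add: add.commute)
        also have "\<dots> = s ! j'" using per that j i(1) by (auto simp: is_period_def)
        finally show ?thesis .
      qed
      then have "s ! j \<le> s ! (p - k + j)"
        using assms(1) i(1) j unfolding below_suffixes_def
        by (metis (no_types, lifting) add_lessD1 add.commute)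
      moreover have "s ! (j + p) = s ! j" using per j(1) i(1) unfolding is_period_def by metis
      ultimately show False using lt j by simp
    qed
    then show ?thesis using eq lt by blast
  qed
  have "\<exists>i. k + i < p \<and> (\<forall>j<i. take p s ! (k + j) = take p s ! j) \<and> take p s ! i < take p s ! (k + i)"
    if k: "0 < k" "k < p" for k
  proof -
    obtain i where i: "k + i < p" "\<forall>j<i. s ! (k + j) = s ! j" "s ! i < s ! (k + i)"
      using ex[OF k] by blast
    then show ?thesis by (intro exI[of _ i]) simp
  qed
  then have "lyndon_list (take p s)"
    using per le assms(2) by (simp add: lyndon_list_def is_period_def)
  with per le show ?thesis using that by blast
qed

lemma period_decomposition:
  assumes "is_period p s" and "k * p \<le> length s"
  shows "s = concat (replicate k (take p s)) @ drop (k * p) s"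
    and "take p (drop (k * p) s) = take (length s - k * p) (take p s)"
proof -
  have tk: "take p (drop (k * p) s) = take (length s - k * p) (take p s)" if "k * p \<le> length s" for k
  proof (rule nth_equalityI)
    fix i assume i: "i < length (take p (drop (k * p) s))"
    have "k * p + i < length s \<Longrightarrow> s ! (k * p + i) = s ! i" for k
    proof (induction k)
      case (Suc k)
      then show ?case using assms(1) unfolding is_period_def
        by (metis add.assoc add.commute add_lessD1 mult_Suc)
    qed simp
    then show "take p (drop (k * p) s) ! i = take (length s - k * p) (take p s) ! i"
      using i that by auto
  qed auto
  from tk[OF assms(2)] show "take p (drop (k * p) s) = take (length s - k * p) (take p s)" .
  from assms(2) show "s = concat (replicate k (take p s)) @ drop (k * p) s"
  proof (induction k)
    case (Suc k)
    then have "s = concat (replicate k (take p s)) @ drop (k * p) s" by simp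
    also have "drop (k * p) s = take p (drop (k * p) s) @ drop (Suc k * p) s"
      by (metis append_take_drop_id drop_drop mult_Suc)
    also have "take p (drop (k * p) s) = take p s"
      using tk[of k] Suc.prems by simp
    also have "concat (replicate k (take p s)) @ take p s @ drop (Suc k * p) s
        = concat (replicate (Suc k) (take p s)) @ drop (Suc k * p) s"
      by (simp flip: replicate_append_same)
    finally show ?case .
  qed simp
qed

lemma lyndon_list_below_suffixes:
  assumes "lyndon_list v"
  shows "below_suffixes v"
  unfolding below_suffixes_def
proof (intro allI impI)
  fix k i assume i: "k + i < length v \<and> (\<forall>j<i. v ! (k + j) = v ! j)"
  show "v ! i \<le> v ! (k + i)"
  proof (cases "k = 0")
    case False
    then obtain i' where i': "k + i' < length v" "\<forall>j<i'. v ! (k + j) = v ! j" "v ! i' < v ! (k + i')"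
      using assms i unfolding lyndon_list_def by (metis add_lessD1 not_gr_zero)
    show ?thesis using i i' by (cases i i' rule: linorder_cases) force+
  qed simp
qed

lemma below_suffixes_take:
  assumes "below_suffixes v"
  shows "below_suffixes (take n v)"
  unfolding below_suffixes_def
proof (intro allI impI, elim conjE)
  fix k i assume "k + i < length (take n v)" "\<forall>j<i. take n v ! (k + j) = take n v ! j"
  then show "take n v ! i \<le> take n v ! (k + i)"
    using assms[unfolded below_suffixes_def, rule_format, of k i] by simp
qed

text \<open>
  Here \<open>|u|\<close> is the least period of \<open>v\<close> without its last letter, and \<open>t = u' c\<close> is the final incomplete
  period together with the last letter of \<open>v\<close>.
\<close>

lemma lyndon_list_factorization:
  fixes v :: "'a::linorder list"
  assumes "lyndon_list v" and "2 \<le> length v"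
  obtains k u t where "v = concat (replicate k u) @ t" "0 < k" "lyndon_list u"
    "0 < length t" "length t \<le> length u" "length u < length v"
    "butlast t = take (length t - 1) u" "take (length t) u < t"
proof -
  define n where "n = length v - 1"
  define s where "s = take n v"
  have n: "0 < n" "length s = n" "length v = Suc n" using assms(2) by (auto simp: n_def s_def)
  have v: "v = s @ [v ! n]"
    unfolding s_def using n(3) by (metis lessI order_refl take_Suc_conv_app_nth take_all)
  have "below_suffixes s"
    unfolding s_def by (intro below_suffixes_take lyndon_list_below_suffixes assms)
  moreover have "s \<noteq> []" using n by auto
  ultimately obtain p where p: "is_period p s" "p \<le> length s" "lyndon_list (take p s)"
    by (rule least_period_lyndon)
  define u where "u = take p s"
  define k where "k = n div p"
  define t where "t = drop (k * p) s @ [v ! n]"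
  have p0: "0 < p" using p(1) by (simp add: is_period_def)
  have kp: "k * p \<le> length s" using n by (simp add: k_def)
  have k0: "0 < k" using p0 p(2) n by (simp add: k_def div_greater_zero_iff)
  have lu: "length u = p" using p(2) by (simp add: u_def)
  have "n - k * p = n mod p" by (simp add: k_def minus_div_mult_eq_mod)
  then have lt: "n - k * p < p" using p0 by simp
  have dt: "drop (k * p) s = take (n - k * p) u"
    using period_decomposition(2)[OF p(1) kp] lt n by (simp add: u_def)
  have v_eq: "v = concat (replicate k u) @ t"
    using period_decomposition(1)[OF p(1) kp] v unfolding t_def u_def
    by (metis append.assoc)
  have lent: "length t = Suc (n - k * p)" using n by (simp add: t_def)
  \<comment> \<open>No \<open>p < |v|\<close> is a period of a Lyndon word \<open>v\<close>, so the last letter breaks the period \<open>p\<close>; it does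
    so upwards because the suffix at \<open>p\<close> is above \<open>v\<close>.\<close>
  have "u ! (n - k * p) < v ! n"
  proof -
    obtain i where i: "p + i < length v" "\<forall>j<i. v ! (p + j) = v ! j" "v ! i < v ! (p + i)"
      using assms(1) p0 p(2) n unfolding lyndon_list_def by (metis le_imp_less_Suc)
    have sv: "s ! j = v ! j" if "j < n" for j using that by (simp add: s_def)
    have "\<not> p + i < n"
    proof
      assume "p + i < n"
      then have "s ! (i + p) = s ! i" using p(1) n by (auto simp: is_period_def)
      then show False using i(3) sv \<open>p + i < n\<close> by (simp add: add.commute)
    qed
    then have pi: "p + i = n" using i(1) n by simp
    \<comment> \<open>The broken comparison is with the place \<open>n - p\<close>, which lies \<open>k - 1\<close> periods to the right of
      the place \<open>j\<close> in \<open>u\<close>.\<close>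
    define j where "j = n - k * p"
    have "s ! (m * p + j) = s ! j" if "m * p + j < n" for m using that
    proof (induction m)
      case (Suc m)
      then show ?case using p(1) n unfolding is_period_def
        by (metis add.assoc add.commute add_lessD1 mult_Suc)
    qed simp
    moreover have "i = (k - 1) * p + j"
      using pi kp n k0 p0 unfolding j_def by (cases k) auto
    ultimately have "s ! i = s ! j" using pi p0 by (metis less_add_same_cancel2)
    moreover have "u ! j = s ! j" using lt by (simp add: j_def u_def)
    ultimately show ?thesis using i(3) pi sv p0 by (simp add: j_def)
  qed
  then have less: "take (length t) u < t"
    using lt by (simp add: lent t_def dt take_Suc_conv_app_nth lu append_less_append_same)
  have "lyndon_list u" using p(3) by (simp add: u_def)
  moreover have "butlast t = take (length t - 1) u" by (simp add: lent) (simp add: t_def dt)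
  moreover have "0 < length t" "length t \<le> length u" "length u < length v"
    using lt lent lu n p(2) by simp_all
  ultimately show ?thesis using that[OF v_eq k0] less by blast
qed

section \<open>Finite Lyndon words are above their shuffles\<close>

definition above_own_shuffles :: "'a::linorder list \<Rightarrow> bool" where
  "above_own_shuffles u \<longleftrightarrow> (\<forall>a b. 0 < a \<and> 0 < b \<and> a + b = length u \<longrightarrow>
    (\<forall>x \<in> shuffles (take a u) (take b u). x < u))"

text \<open>
  A shuffle that exceeded the prefix of \<open>u\<close> of its length could be completed, by appending letters to the
  second prefix, to a shuffle above \<open>u\<close>.
\<close>

lemma shuffle_short_prefixes_le:
  fixes u :: "'a::linorder list"
  assumes u: "above_own_shuffles u"
    and x: "x \<in> shuffles (take a u) (take b u)" and l: "a + b \<le> length u"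
  shows "x \<le> take (a + b) u"
proof (cases "a = 0 \<or> b = 0")
  case True
  then show ?thesis using x by auto
next
  case False
  let ?e = "take (length u - (a + b)) (drop b u)"
  have "x @ ?e \<in> shuffles (take a u @ []) (take b u @ ?e)"
    using x by (rule shuffles_append) simp
  also have "take b u @ ?e = take (length u - a) u"
    using l by (simp flip: take_add)
  finally have "x @ ?e < u" using u[unfolded above_own_shuffles_def, rule_format, of a "length u - a"] False l by auto
  then have "\<not> take (a + b) u < x"
    using append_less_append[of "take (a + b) u" x "drop (a + b) u" ?e] length_shuffles[OF x] l
    by auto
  then show ?thesis by simp
qed

text \<open>
  The words \<open>u\<^sup>i t\<close> and \<open>u\<^sup>j t\<close> are what is left of two copies of \<open>u\<^sup>k t\<close> after \<open>k - m\<close> pieces \<open>u\<close> have been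
  read, each from one of the copies. The two excluded cases are those in which the shuffle equals
  \<open>u\<^sup>m t\<close> because it is read from one word only; that word has exactly \<open>m\<close> powers left, and nothing is
  read from the other one.
\<close>

lemma shuffle_of_powers_less:
  fixes u t :: "'a::linorder list"
  assumes u: "above_own_shuffles u"
    and t: "0 < length t" "length t \<le> length u" "butlast t = take (length t - 1) u"
      "take (length t) u < t"
  defines "pw \<equiv> \<lambda>m. concat (replicate m u) @ t"
  assumes "x \<in> shuffles (take a (pw i)) (take b (pw j))" and "a + b = length (pw m)"
    and "m \<le> i" and "m \<le> j" and "\<not> (i = m \<and> b = 0)" and "\<not> (j = m \<and> a = 0)"
  shows "x < pw m"
  using assms(7-)
proof (induction m arbitrary: x a b i j)
  case 0
  let ?l = "length t"
  have l: "a + b = ?l" using 0 by (simp add: pw_def)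
  have short: "take e t = take e u" if "e < ?l" for e
    using take_butlast[of e t] that by (simp add: t(3) min_def split: if_splits)
  have pre: "take e (pw n) = take e u" if "0 < n \<and> e \<le> ?l \<or> e < ?l" for e n
  proof (cases n)
    case 0
    then show ?thesis using short that by (simp add: pw_def)
  next
    case (Suc n')
    have "e \<le> length u" using that t(2) by linarith
    then show ?thesis by (simp add: pw_def Suc)
  qed
  \<comment> \<open>The last letter of \<open>t\<close> is out of reach, so only letters of \<open>u\<close> are shuffled.\<close>
  have "take a (pw i) = take a u" and "take b (pw j) = take b u"
    using 0 l pre by auto
  then have "x \<le> take (a + b) u"
    using shuffle_short_prefixes_le[OF u, of x a b] 0(1) l t(2) by simp
  then show ?case using t(4) l by (simp add: pw_def)
next
  case (Suc m)
  let ?p = "length u"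
  have pw_Suc: "pw (Suc n) = u @ pw n" for n by (simp add: pw_def)
  obtain i' j' where ij: "i = Suc i'" "j = Suc j'" "m \<le> i'" "m \<le> j'"
    using Suc.prems by (metis Suc_le_D Suc_le_mono)
  have lx: "length x = ?p + length (pw m)"
  proof -
    have "length (pw n) = n * ?p + length t" for n by (simp add: pw_def length_concat sum_list_replicate)
    then have "length (pw (Suc m)) \<le> length (pw i)" "length (pw (Suc m)) \<le> length (pw j)"
      using Suc.prems by (auto intro: mult_le_mono1 simp del: mult_Suc)
    then show ?thesis using length_shuffles[OF Suc.prems(1)] Suc.prems(2) pw_Suc by auto
  qed
  obtain a' b' where ab: "a' + b' = ?p" "a' \<le> length (take a (pw i))" "b' \<le> length (take b (pw j))"
    "take ?p x \<in> shuffles (take a' (take a (pw i))) (take b' (take b (pw j)))"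
    "drop ?p x \<in> shuffles (drop a' (take a (pw i))) (drop b' (take b (pw j)))"
    using shuffles_split[OF Suc.prems(1), of ?p] lx by auto
  have le: "a' \<le> a" "b' \<le> b" using ab by auto
  have first: "take ?p x \<in> shuffles (take a' u) (take b' u)"
    using ab(1,4) le by (simp add: ij pw_Suc min_absorb1)
  have x: "x = take ?p x @ drop ?p x" by simp
  consider "0 < a'" "0 < b'" | "b' = 0" "a' = ?p" | "a' = 0" "b' = ?p" using ab(1) by fastforce
  then show ?case
  proof cases
    case 1
    then have "take ?p x < u" using u first ab(1) by (auto simp: above_own_shuffles_def)
    then show ?thesis using append_less_append[of "take ?p x" u "drop ?p x" "pw m"] lx
      by (simp add: pw_Suc)
  next
    case 2
    have "drop ?p x \<in> shuffles (take (a - ?p) (pw i')) (take b (pw j))"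
      using ab(5) 2 le by (simp add: ij pw_Suc drop_take min_absorb1)
    moreover have "a - ?p + b = length (pw m)" using Suc.prems(2) 2 le pw_Suc by simp
    ultimately have "drop ?p x < pw m"
      using Suc.IH[of "drop ?p x" "a - ?p" i' b j] Suc.prems ij by auto
    moreover have "take ?p x = u" using first 2 by simp
    ultimately show ?thesis using x append_less_append_same by (metis pw_Suc)
  next
    case 3
    have "drop ?p x \<in> shuffles (take a (pw i)) (take (b - ?p) (pw j'))"
      using ab(5) 3 le by (simp add: ij pw_Suc drop_take min_absorb1)
    moreover have "a + (b - ?p) = length (pw m)" using Suc.prems(2) 3 le pw_Suc by simp
    ultimately have "drop ?p x < pw m"
      using Suc.IH[of "drop ?p x" a i "b - ?p" j'] Suc.prems ij by auto
    moreover have "take ?p x = u" using first 3 by simp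
    ultimately show ?thesis using x append_less_append_same by (metis pw_Suc)
  qed
qed

lemma lyndon_list_above_own_shuffles:
  assumes "lyndon_list v"
  shows "above_own_shuffles v"
  using assms
proof (induction "length v" arbitrary: v rule: less_induct)
  case (less v)
  show ?case
    unfolding above_own_shuffles_def
  proof (intro allI impI ballI, elim conjE)
    fix a b x
    assume ab: "0 < a" "0 < b" "a + b = length v" and x: "x \<in> shuffles (take a v) (take b v)"
    from ab have "2 \<le> length v" by simp
    with less.prems obtain k u t where f: "v = concat (replicate k u) @ t" "0 < k" "lyndon_list u"
      "0 < length t" "length t \<le> length u" "length u < length v"
      "butlast t = take (length t - 1) u" "take (length t) u < t"
      by (rule lyndon_list_factorization)
    have "above_own_shuffles u" using less.hyps f(3,6) by blast
    from shuffle_of_powers_less[OF this f(4,5,7,8), where x = x and a = a and b = b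
        and i = k and j = k and m = k]
    show "x < v" using ab x f(1,2) by simp
  qed
qed


section \<open>Prefixes of infinite shuffles\<close>

text \<open>
  Prefixes of length \<open>Suc d\<close> are treated as a whole below and should not be split by simplification.
\<close>

declare subseq_to_Suc [simp del]

lemma shuffle_of_blocks:
  "concat (map (\<lambda>i. U i @ V i) ns) \<in> shuffles (concat (map U ns)) (concat (map V ns))"
proof (induction ns)
  case (Cons n ns)
  have "U n @ V n \<in> shuffles (U n @ []) ([] @ V n)"
    by (rule shuffles_append) simp_all
  from shuffles_append[OF this Cons] show ?case by simp
qed simp

lemma concat_blocks_add:
  "concat (map W [0..<N + n]) = concat (map W [0..<N]) @ concat (map (\<lambda>i. W (N + i)) [0..<n])"
proof -
  have "[0..<N + n] = [0..<N] @ [N..<N + n]" by (rule upt_add_eq_append) simp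
  moreover have "[N..<N + n] = map (\<lambda>i. N + i) [0..<n]"
    using map_add_upt[of N n] by (simp only: add.commute)
  ultimately show ?thesis by (simp only: map_append concat_append map_map comp_def)
qed

lemma is_inf_prod_suffix:
  assumes "is_inf_prod W w"
  shows "is_inf_prod (\<lambda>i. W (N + i)) (suffix (length (concat (map W [0..<N]))) w)"
  unfolding is_inf_prod_def
proof (intro conjI allI)
  let ?P = "\<lambda>n. concat (map W [0..<n])" and ?Q = "\<lambda>n. concat (map (\<lambda>i. W (N + i)) [0..<n])"
  have split: "?P (N + n) = ?P N @ ?Q n" for n by (rule concat_blocks_add)
  have pre: "prefix (length (?P n)) w = ?P n" for n
    using assms by (simp add: is_inf_prod_def)
  show "prefix (length (?Q n)) (suffix (length (?P N)) w) = ?Q n" for n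
  proof -
    have "?P N @ prefix (length (?Q n)) (suffix (length (?P N)) w) = ?P N @ ?Q n"
      using pre[of "N + n"] pre[of N] unfolding split by (simp add: subsequence_append)
    then show ?thesis by simp
  qed
  show "\<exists>n. k \<le> length (?Q n)" for k
  proof -
    obtain n where n: "length (?P N) + k \<le> length (?P n)"
      using assms unfolding is_inf_prod_def by blast
    also have "\<dots> \<le> length (?P (n + N))" unfolding concat_blocks_add[of W n N] by simp
    finally show ?thesis unfolding add.commute[of n N] split by auto
  qed
qed

lemma is_inf_prod_prefix:
  assumes "is_inf_prod W w" and "l \<le> length (concat (map W [0..<n]))"
  shows "prefix l w = take l (concat (map W [0..<n]))"
proof -
  have "take l (concat (map W [0..<n])) = take l (prefix (length (concat (map W [0..<n]))) w)"
    using assms(1) unfolding is_inf_prod_def by metis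
  also have "\<dots> = prefix l w" using assms(2) by simp
  finally show ?thesis by simp
qed

text \<open>
  A prefix of an infinite shuffle may end inside a block, so it is obtained by cutting a long finite
  product. Letters \<open>x1\<close> known to be read at the beginning guarantee that the cut takes at least \<open>p1\<close>
  from \<open>y\<close> and \<open>q1\<close> from \<open>z\<close>.
\<close>

lemma prefix_of_inf_shuffle:
  assumes w: "is_inf_prod (\<lambda>i. U i @ V i) w" and y: "is_inf_prod U y" and z: "is_inf_prod V z"
    and first: "x1 \<in> shuffles p1 q1" and rest: "x2 \<in> shuffles p2 q2"
    and N: "concat (map (\<lambda>i. U i @ V i) [0..<N]) = x1 @ x2"
      "concat (map U [0..<N]) = p1 @ p2" "concat (map V [0..<N]) = q1 @ q2"
    and l: "length x1 \<le> l"
  obtains a b where "a + b = l" "length p1 \<le> a" "length q1 \<le> b"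
    "prefix l w \<in> shuffles (prefix a y) (prefix b z)"
proof -
  obtain n where n: "l \<le> length (concat (map (\<lambda>i. U i @ V i) [0..<N + n]))"
  proof -
    obtain n where "l \<le> length (concat (map (\<lambda>i. U i @ V i) [0..<n]))"
      using w unfolding is_inf_prod_def by blast
    also have "\<dots> \<le> length (concat (map (\<lambda>i. U i @ V i) [0..<n + N]))"
      unfolding concat_blocks_add[of _ n N] by simp
    finally show ?thesis using that by (simp add: add.commute)
  qed
  let ?R = "\<lambda>W. concat (map (\<lambda>i. W (N + i)) [0..<n])"
  have X: "concat (map (\<lambda>i. U i @ V i) [0..<N + n]) = x1 @ x2 @ ?R (\<lambda>i. U i @ V i)"
    and P: "concat (map U [0..<N + n]) = p1 @ p2 @ ?R U"
    and Q: "concat (map V [0..<N + n]) = q1 @ q2 @ ?R V"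
    by (simp_all only: concat_blocks_add N append_assoc)
  have "x2 @ ?R (\<lambda>i. U i @ V i) \<in> shuffles (p2 @ ?R U) (q2 @ ?R V)"
    by (intro shuffles_append rest shuffle_of_blocks)
  moreover have "l - length x1 \<le> length (x2 @ ?R (\<lambda>i. U i @ V i))" using n unfolding X by simp
  ultimately obtain a b where ab: "a + b = l - length x1" "a \<le> length (p2 @ ?R U)"
    "b \<le> length (q2 @ ?R V)" "take (l - length x1) (x2 @ ?R (\<lambda>i. U i @ V i))
      \<in> shuffles (take a (p2 @ ?R U)) (take b (q2 @ ?R V))"
    by (rule shuffles_split)
  have "prefix l w = x1 @ take (l - length x1) (x2 @ ?R (\<lambda>i. U i @ V i))"
    unfolding is_inf_prod_prefix[OF w n] X using l by simp
  moreover have "prefix (length p1 + a) y = p1 @ take a (p2 @ ?R U)"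
    using is_inf_prod_prefix[OF y, of "length p1 + a" "N + n"] ab(2) unfolding P by simp
  moreover have "prefix (length q1 + b) z = q1 @ take b (q2 @ ?R V)"
    using is_inf_prod_prefix[OF z, of "length q1 + b" "N + n"] ab(3) unfolding Q by simp
  ultimately have "prefix l w \<in> shuffles (prefix (length p1 + a) y) (prefix (length q1 + b) z)"
    using shuffles_append[OF first ab(4)] by simp
  moreover have "length p1 + a + (length q1 + b) = l"
    using ab(1) l length_shuffles[OF first] by simp
  ultimately show ?thesis using that le_add1 by blast
qed

section \<open>Lyndon prefixes of infinite words\<close>

abbreviation (input) less_eq_rel :: "'a::linorder rel" where
  "less_eq_rel \<equiv> {(a, b). a \<le> b}"

lemma lex_less_if_prefix_less:
  fixes w z :: "'a::linorder word"
  assumes "prefix l w < prefix l z"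
  shows "lex_less less_eq_rel w z"
proof -
  obtain i where "i < l" "\<forall>j<i. w j = z j" "w i < z i"
    using assms by (auto simp: less_list_iff_first_difference)
  then show ?thesis unfolding lex_less_def by (intro exI[of _ i]) (simp add: less_le)
qed

text \<open>
  A factor of \<open>z\<close> is a factor of \<open>y\<close>, that is, a prefix of a suffix of \<open>y\<close>, and no suffix of \<open>y\<close> is
  below \<open>y\<close>.
\<close>

lemma lyndon_le_factors:
  assumes y: "lyndon less_eq_rel y" and z: "z \<in> shift_orbit_closure y"
    and eq: "\<forall>j<i. z (k + j) = y j"
  shows "y i \<le> z (k + i)"
proof -
  have "z [k \<rightarrow> k + Suc i] \<in> factors z" unfolding factors_def by (metis (mono_tags, lifting) le_add1 mem_Collect_eq)
  then obtain m m' where m: "(z [k \<rightarrow> k + Suc i]) = (y [m \<rightarrow> m'])"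
    using z unfolding shift_orbit_closure_def factors_def by blast
  then have len: "m' - m = Suc i" by (metis subsequence_length add_diff_cancel_left')
  have zy: "z (k + j) = y (m + j)" if "j \<le> i" for j
    using arg_cong[OF m, of "\<lambda>x. x ! j"] that len by simp
  show ?thesis
  proof (cases "m = 0")
    case False
    then have "lex_less less_eq_rel y (suffix m y)" using y by (simp add: lyndon_def)
    then obtain n where n: "\<And>j. j < n \<Longrightarrow> y j = y (m + j)" "y n < y (m + n)"
      unfolding lex_less_def suffix_nth mem_Collect_eq case_prod_conv by (metis order_le_less)
    consider "n < i" | "n = i" | "i < n" by linarith
    then show ?thesis
    proof cases
      case 1
      then show ?thesis using n(2) zy[of n] eq by simp
    next
      case 2
      then show ?thesis using n(2) zy[of i] by simp
    next
      case 3
      then show ?thesis using n(1)[OF 3] zy[of i] by (metis order_refl)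
    qed
  qed (use zy in simp)
qed

text \<open>
  None of the finitely many numbers below \<open>N\<close> is a period of \<open>y\<close>, so a sufficiently long prefix of \<open>y\<close>
  has a least period of at least \<open>N\<close>, which is the length of a Lyndon prefix.
\<close>

lemma lyndon_long_lyndon_prefix:
  assumes y: "lyndon less_eq_rel y"
  obtains n where "N \<le> n" "lyndon_list (prefix n y)"
proof -
  have "\<exists>M. \<forall>p<N. \<not> is_period p (prefix M y)"
  proof (induction N)
    case (Suc N)
    then obtain M where M: "\<forall>p<N. \<not> is_period p (prefix M y)" by blast
    obtain i where i: "N = 0 \<or> y (N + i) \<noteq> y i"
      using y unfolding lyndon_def lex_less_def by (metis not_gr_zero suffix_nth)
    let ?M = "max M (Suc (i + N))"
    have "\<not> is_period N (prefix ?M y)"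
      using i by (auto simp: is_period_def add.commute intro!: exI[of _ i])
    moreover have "is_period p (prefix M y)" if "is_period p (prefix ?M y)" for p
      using that by (auto simp: is_period_def)
    ultimately have "\<forall>p<Suc N. \<not> is_period p (prefix ?M y)"
      using M by (auto simp: less_Suc_eq)
    then show ?case by blast
  qed simp
  then obtain M where M: "\<forall>p<N. \<not> is_period p (prefix M y)" by blast
  have "y \<in> shift_orbit_closure y" by (simp add: shift_orbit_closure_def)
  note le = lyndon_le_factors[OF y this]
  have "below_suffixes (prefix (Suc M) y)"
    unfolding below_suffixes_def
  proof (intro allI impI, elim conjE)
    fix k i
    assume "k + i < length (prefix (Suc M) y)"
      and "\<forall>j<i. prefix (Suc M) y ! (k + j) = prefix (Suc M) y ! j"
    then show "prefix (Suc M) y ! i \<le> prefix (Suc M) y ! (k + i)"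
      using le[of i k] by simp
  qed
  moreover have "prefix (Suc M) y \<noteq> []" by simp
  ultimately obtain p where p: "is_period p (prefix (Suc M) y)" "p \<le> length (prefix (Suc M) y)"
    "lyndon_list (take p (prefix (Suc M) y))"
    by (rule least_period_lyndon)
  have "is_period p (prefix M y)" using p(1) by (auto simp: is_period_def)
  then have "N \<le> p" using M by (metis not_le_imp_less)
  with p that show ?thesis by simp
qed

text \<open>
  A suffix of the raised prefix is not below the prefix of \<open>y\<close> of the same length. Equality would mean
  that the large last letter continues the comparison of \<open>y\<close> with one of its suffixes by an equality;
  the smaller letter of \<open>y\<close> at the same place would then put this suffix below \<open>y\<close>.
\<close>

lemma raised_prefix_lyndon:
  fixes y z :: "'a::linorder word"
  assumes y: "\<And>i k. \<forall>j<i. y (k + j) = y j \<Longrightarrow> y i \<le> y (k + i)"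
    and z: "\<And>i k. \<forall>j<i. z (k + j) = y j \<Longrightarrow> y i \<le> z (k + i)"
    and d: "\<forall>j<d. y j = z j" "y d < z d"
  shows "lyndon_list (prefix (Suc d) z)"
  unfolding lyndon_list_def
proof (intro conjI allI impI)
  fix k assume k: "0 < k \<and> k < length (prefix (Suc d) z)"
  have "\<exists>i. k + i \<le> d \<and> z (k + i) \<noteq> z i"
  proof (rule ccontr)
    assume *: "\<not> ?thesis"
    have "y (k + j) = y j" if "j < d - k" for j
      using * that d(1) by (metis add_lessD1 add.commute less_diff_conv less_imp_le)
    then have "y (d - k) \<le> y d" using y[of "d - k" k] k by simp
    moreover have "z d = y (d - k)" using * k d(1)
      by (metis diff_less le_add_diff_inverse less_Suc_eq_le order_refl order_le_less_trans
          subsequence_length diff_zero not_less_eq)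
    ultimately show False using d(2) by simp
  qed
  then obtain i where i: "k + i \<le> d" "z (k + i) \<noteq> z i" "\<forall>j<i. z (k + j) = z j"
    using exists_least_iff[of "\<lambda>i. k + i \<le> d \<and> z (k + i) \<noteq> z i"] by auto
  have "z (k + j) = y j" if "j < i" for j
  proof -
    have "z (k + j) = z j" using i(3) that by blast
    also have "\<dots> = y j" using d(1) i(1) that by simp
    finally show ?thesis .
  qed
  then have "y i \<le> z (k + i)" using z by blast
  moreover have "y i = z i" using d(1) i(1) k by simp
  ultimately have "z i < z (k + i)" using i(2) by (metis order_le_less)
  with i(1,3) show "\<exists>i. k + i < length (prefix (Suc d) z) \<and>
      (\<forall>j<i. prefix (Suc d) z ! (k + j) = prefix (Suc d) z ! j) \<and>
      prefix (Suc d) z ! i < prefix (Suc d) z ! (k + i)"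
    by (intro exI[of _ i]) simp
qed simp

section \<open>Infinite shuffles with a Lyndon word\<close>

text \<open>
  The hypothesis that the first block of \<open>y\<close> is nonempty makes \<open>w\<close> leave \<open>z\<close> at the very first letter,
  so that a nonempty prefix of \<open>y\<close> takes part in every prefix of \<open>w\<close>.
\<close>

lemma shuffle_starting_with_lyndon_less:
  fixes y z w :: "'a::linorder word"
  assumes y: "lyndon less_eq_rel y"
    and z: "\<And>i k. \<forall>j<i. z (k + j) = y j \<Longrightarrow> y i \<le> z (k + i)"
    and prods: "is_inf_prod (\<lambda>i. U i @ V i) w" "is_inf_prod U y" "is_inf_prod V z"
    and U0: "U 0 \<noteq> []"
  shows "lex_less less_eq_rel w z"
proof (cases "z = y")
  case True
  obtain N where "1 \<le> length (concat (map V [0..<N]))"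
    using prods(3) unfolding is_inf_prod_def by blast
  then have V: "concat (map V [0..<N]) \<noteq> []" by (metis le_numeral_extra(2) list.size(3))
  then have "0 < N" by (cases N) auto
  then have U: "concat (map U [0..<N]) \<noteq> []" using U0 by auto
  obtain l where l: "length (concat (map (\<lambda>i. U i @ V i) [0..<N])) \<le> l" "lyndon_list (prefix l y)"
    using y by (rule lyndon_long_lyndon_prefix)
  obtain a b where ab: "a + b = l" "length (concat (map U [0..<N])) \<le> a"
      "length (concat (map V [0..<N])) \<le> b" "prefix l w \<in> shuffles (prefix a y) (prefix b z)"
    by (rule prefix_of_inf_shuffle[OF prods shuffle_of_blocks, where ?x2.0 = "[]"
          and ?p2.0 = "[]" and ?q2.0 = "[]" and N = N and l = l]) (use l(1) in auto)
  have "0 < a" "0 < b" using ab(2,3) U V by (metis le_zero_eq length_0_conv not_gr_zero)+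
  moreover have "prefix a y = take a (prefix l y)" "prefix b z = take b (prefix l y)"
    using ab(1) True by simp_all
  ultimately have "prefix l w < prefix l y"
    using lyndon_list_above_own_shuffles[OF l(2)] ab by (auto simp: above_own_shuffles_def)
  then show ?thesis unfolding True by (rule lex_less_if_prefix_less)
next
  case False
  then have "\<exists>d. y d \<noteq> z d" by auto
  then obtain d where d: "\<forall>j<d. y j = z j" "y d \<noteq> z d"
    using exists_least_iff[of "\<lambda>d. y d \<noteq> z d"] by auto
  then have less: "y d < z d" using z[of d 0] by simp
  obtain c u where c: "U 0 = c # u" using U0 by (cases "U 0") auto
  have "u @ V 0 \<in> shuffles (u @ []) ([] @ V 0)" by (rule shuffles_append) simp_all
  then obtain a b where ab: "a + b = Suc d" "length [c] \<le> a"
      "prefix (Suc d) w \<in> shuffles (prefix a y) (prefix b z)"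
    by (rule prefix_of_inf_shuffle[OF prods, where ?x1.0 = "[c]" and ?p1.0 = "[c]" and ?q1.0 = "[]"
          and N = 1 and l = "Suc d", rotated]) (auto simp: c)
  \<comment> \<open>If \<open>b > 0\<close> then \<open>a \<le> d\<close>, and the letters taken from \<open>y\<close> form a prefix of \<open>z\<close> as well.\<close>
  have "prefix (Suc d) w < prefix (Suc d) z"
  proof (cases "b = 0")
    case True
    then have "prefix (Suc d) w = prefix (Suc d) y" using ab by simp
    then show ?thesis using d(1) less by (auto simp: less_list_iff_first_difference intro!: exI[of _ d])
  next
    case False
    have "y \<in> shift_orbit_closure y" by (simp add: shift_orbit_closure_def)
    from raised_prefix_lyndon[OF lyndon_le_factors[OF y this] z d(1) less]
    have "above_own_shuffles (prefix (Suc d) z)" by (rule lyndon_list_above_own_shuffles)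
    moreover have "prefix a y = take a (prefix (Suc d) z)"
      using d(1) ab(1) False by (auto simp: list_eq_iff_nth_eq)
    moreover have "prefix b z = take b (prefix (Suc d) z)" using ab(1) by simp
    moreover have "0 < a" "0 < b" using ab(2) False by simp_all
    ultimately have "\<forall>x \<in> shuffles (prefix a y) (prefix b z). x < prefix (Suc d) z"
      unfolding above_own_shuffles_def using ab(1) by simp
    then show ?thesis using ab(3) by blast
  qed
  then show ?thesis by (rule lex_less_if_prefix_less)
qed

lemma lex_less_append:
  assumes "prefix m w = prefix m z" and "lex_less r (suffix m w) (suffix m z)"
  shows "lex_less r w z"
proof -
  obtain n where n: "\<forall>i<n. w (m + i) = z (m + i)" "w (m + n) \<noteq> z (m + n)" "(w (m + n), z (m + n)) \<in> r"
    using assms(2) by (auto simp: lex_less_def)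
  have "w i = z i" if "i < m + n" for i
  proof (cases "i < m")
    case True
    then show ?thesis using arg_cong[OF assms(1), of "\<lambda>x. x ! i"] by simp
  next
    case False
    then show ?thesis using n(1)[rule_format, of "i - m"] that by simp
  qed
  then show ?thesis using n unfolding lex_less_def by blast
qed

lemma inf_shuffle_lyndon_less:
  fixes y z w :: "'a::linorder word"
  assumes y: "lyndon less_eq_rel y" and z: "z \<in> shift_orbit_closure y"
    and w: "w \<in> inf_shuffles UNIV y z"
  shows "lex_less less_eq_rel w z"
proof -
  obtain U V where prods: "is_inf_prod (\<lambda>i. U i @ V i) w" "is_inf_prod U y" "is_inf_prod V z"
    using w unfolding inf_shuffles_def by blast
  obtain n where "1 \<le> length (concat (map U [0..<n]))"
    using prods(2) unfolding is_inf_prod_def by blast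
  then have "\<exists>i. U i \<noteq> []" by (metis concat_eq_Nil_conv le_numeral_extra(2) list.size(3) ex_map_conv)
  then obtain N where N: "U N \<noteq> []" "\<forall>i<N. U i = []"
    using exists_least_iff[of "\<lambda>i. U i \<noteq> []"] by auto
  \<comment> \<open>The length of the initial run of letters taken from \<open>z\<close>.\<close>
  define m where "m = length (concat (map V [0..<N]))"
  have U: "concat (map U [0..<N]) = []" using N(2) by simp
  have UV: "concat (map (\<lambda>i. U i @ V i) [0..<N]) = concat (map V [0..<N])"
    using N(2) by (intro arg_cong[of _ _ concat] map_cong) auto
  have "lex_less less_eq_rel (suffix m w) (suffix m z)"
  proof (rule shuffle_starting_with_lyndon_less[OF y])
    show "y i \<le> suffix m z (k + i)" if "\<forall>j<i. suffix m z (k + j) = y j" for i k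
      using lyndon_le_factors[OF y z, of i "m + k"] that by (simp add: add.assoc)
    show "is_inf_prod (\<lambda>i. U (N + i) @ V (N + i)) (suffix m w)"
      using is_inf_prod_suffix[OF prods(1), of N] by (simp only: UV m_def)
    show "is_inf_prod (\<lambda>i. U (N + i)) y"
      using is_inf_prod_suffix[OF prods(2), of N] by (simp only: U list.size suffix_0)
    show "is_inf_prod (\<lambda>i. V (N + i)) (suffix m z)"
      using is_inf_prod_suffix[OF prods(3), of N] by (simp only: m_def)
  qed (use N in simp)
  moreover have "prefix m w = prefix m z"
    using prods(1,3) UV unfolding is_inf_prod_def m_def by metis
  ultimately show ?thesis using lex_less_append by blast
qed

section \<open>Transfer from an arbitrary finite ordered alphabet\<close>

text \<open>
  A letter is sent to the number of letters that are at most as large.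
\<close>

lemma linear_order_rank:
  assumes "finite A" and r: "linear_order_on A r"
  obtains f :: "'a \<Rightarrow> nat" where "\<And>a b. a \<in> A \<Longrightarrow> b \<in> A \<Longrightarrow> (a, b) \<in> r \<longleftrightarrow> f a \<le> f b"
proof
  let ?D = "\<lambda>b. {a \<in> A. (a, b) \<in> r}"
  have tr: "trans r" and tot: "total_on A r" and "refl_on A r"
    using r by (simp_all add: linear_order_on_def partial_order_on_def preorder_on_def)
  then have refl: "(a, a) \<in> r" if "a \<in> A" for a
    using that by (simp add: refl_onD)
  have mono: "?D a \<subseteq> ?D b" if "(a, b) \<in> r" for a b
    using transD[OF tr _ that] by blast
  fix a b assume A: "a \<in> A" "b \<in> A"
  show "(a, b) \<in> r \<longleftrightarrow> card (?D a) \<le> card (?D b)"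
  proof
    assume "(a, b) \<in> r"
    then show "card (?D a) \<le> card (?D b)" using mono assms(1) by (intro card_mono) auto
  next
    assume le: "card (?D a) \<le> card (?D b)"
    show "(a, b) \<in> r"
    proof (rule ccontr)
      assume "(a, b) \<notin> r"
      then have "(b, a) \<in> r" using tot A refl unfolding total_on_def by metis
      then have "?D b \<subset> ?D a" using mono A refl \<open>(a, b) \<notin> r\<close> by blast
      then have "card (?D b) < card (?D a)" using assms(1) by (intro psubset_card_mono) auto
      then show False using le by simp
    qed
  qed
qed

lemma subsequence_comp: "((f \<circ> w) [i \<rightarrow> j]) = map f (w [i \<rightarrow> j])"
  by (simp add: subsequence_def)

lemma inf_shuffles_comp:
  assumes "w \<in> inf_shuffles A y z"
  shows "f \<circ> w \<in> inf_shuffles UNIV (f \<circ> y) (f \<circ> z)"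
proof -
  have *: "is_inf_prod (\<lambda>i. map f (W i)) (f \<circ> x)" if "is_inf_prod W x" for W x
  proof -
    have "concat (map (\<lambda>i. map f (W i)) ns) = map f (concat (map W ns))" for ns
      by (simp add: map_concat comp_def)
    then show ?thesis using that by (simp add: is_inf_prod_def subsequence_comp)
  qed
  obtain U V where "is_inf_prod (\<lambda>i. U i @ V i) w" "is_inf_prod U y" "is_inf_prod V z"
    using assms unfolding inf_shuffles_def by blast
  from this[THEN *] show ?thesis unfolding inf_shuffles_def by auto
qed

lemma inf_shuffles_range:
  assumes "w \<in> inf_shuffles A y z"
  shows "range w \<subseteq> A"
proof
  fix c assume "c \<in> range w"
  then obtain i where i: "c = w i" by blast
  obtain U V where UV: "\<forall>i. U i \<in> lists A \<and> V i \<in> lists A" "is_inf_prod (\<lambda>i. U i @ V i) w"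
    using assms unfolding inf_shuffles_def by blast
  obtain n where "Suc i \<le> length (concat (map (\<lambda>i. U i @ V i) [0..<n]))"
    using UV(2) unfolding is_inf_prod_def by blast
  then have "prefix (Suc i) w = take (Suc i) (concat (map (\<lambda>i. U i @ V i) [0..<n]))"
    using is_inf_prod_prefix[OF UV(2)] by blast
  moreover have "w i \<in> set (prefix (Suc i) w)" by simp
  ultimately have "w i \<in> set (concat (map (\<lambda>i. U i @ V i) [0..<n]))" by (metis in_set_takeD)
  then show "c \<in> A" using UV(1) i by (auto simp: in_lists_conv_set)
qed

lemma factors_comp: "factors (f \<circ> x) = map f ` factors x"
  by (auto simp: factors_def subsequence_comp)

lemma shift_orbit_closure_range:
  assumes "z \<in> shift_orbit_closure y"
  shows "range z \<subseteq> range y"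
proof
  fix c assume "c \<in> range z"
  then obtain i where "c = z i" by blast
  moreover have "z [i \<rightarrow> Suc i] \<in> factors z" unfolding factors_def by (metis (mono_tags, lifting) le_SucI mem_Collect_eq order_refl)
  ultimately have "[c] \<in> factors y" using assms by (auto simp: shift_orbit_closure_def)
  then obtain j k where "[c] = (y [j \<rightarrow> k])" by (auto simp: factors_def)
  then have "c \<in> set (y [j \<rightarrow> k])" by (metis list.set_intros(1))
  then show "c \<in> range y" by auto
qed

theorem theorem4p2:
  fixes A :: "'a set" and r :: "'a rel" and y :: "'a word"
  assumes "finite A" and "A \<noteq> {}"
    and "linear_order_on A r"
    and "range y \<subseteq> A"
    and "lyndon r y"
  shows "(\<forall>z \<in> shift_orbit_closure y. \<forall>w \<in> inf_shuffles A y z. lex_less r w z)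
    \<and> \<not> self_shuffling A y"
proof -
  obtain f :: "'a \<Rightarrow> nat"
    where f: "\<And>a b. a \<in> A \<Longrightarrow> b \<in> A \<Longrightarrow> (a, b) \<in> r \<longleftrightarrow> f a \<le> f b"
    using linear_order_rank[OF assms(1,3)] by blast
  have "antisym r" using assms(3) by (simp add: linear_order_on_def partial_order_on_def)
  then have inj: "f a = f b \<longleftrightarrow> a = b" if "a \<in> A" "b \<in> A" for a b
    using that f by (metis antisymD order_refl)
  have lex: "lex_less r u v \<longleftrightarrow> lex_less less_eq_rel (f \<circ> u) (f \<circ> v)"
    if "range u \<subseteq> A" "range v \<subseteq> A" for u v
  proof -
    have "u i \<in> A" "v i \<in> A" for i using that by auto
    then show ?thesis by (simp add: lex_less_def f inj)
  qed
  have "lyndon less_eq_rel (f \<circ> y)"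
    unfolding lyndon_def
  proof (intro allI impI)
    fix k :: nat assume "0 < k"
    then have "lex_less r y (suffix k y)" using assms(5) by (simp add: lyndon_def)
    moreover have "range (suffix k y) \<subseteq> A" using assms(4) by auto
    moreover have "f \<circ> suffix k y = suffix k (f \<circ> y)" by (simp add: suffix_def comp_def)
    ultimately show "lex_less less_eq_rel (f \<circ> y) (suffix k (f \<circ> y))"
      using lex assms(4) by metis
  qed
  note y = this
  have less: "lex_less r w z" if z: "z \<in> shift_orbit_closure y" and w: "w \<in> inf_shuffles A y z" for z w
  proof -
    have "f \<circ> z \<in> shift_orbit_closure (f \<circ> y)"
      using z by (auto simp: shift_orbit_closure_def factors_comp)
    then have "lex_less less_eq_rel (f \<circ> w) (f \<circ> z)"
      using inf_shuffle_lyndon_less[OF y] inf_shuffles_comp[OF w] by blast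
    moreover have "range z \<subseteq> A" using shift_orbit_closure_range[OF z] assms(4) by blast
    ultimately show ?thesis using lex inf_shuffles_range[OF w] by blast
  qed
  moreover have "\<not> self_shuffling A y"
  proof
    assume "self_shuffling A y"
    then have "lex_less r y y"
      by (intro less) (auto simp: self_shuffling_def shift_orbit_closure_def)
    then show False by (simp add: lex_less_def)
  qed
  ultimately show ?thesis by blast
qed

end
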